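(* If $(R,\Longrightarrow)$ is a Noetherian reduction ring, then for every $n\ge 1$ the polynomial ring $R[X_1,\dots,X_n]$, with the iterated reduction relation described in the context, is a Noetherian reduction ring.
   Context: $R$ is an associative, not necessarily commutative ring with unit; "ideal" means two-sided ideal, $\mathrm{ideal}_R(B)$ is the ideal generated by $B$, and Noetherian means every ideal is finitely generated. A reduction relation on a ring $R$ is a family of binary relations $\Longrightarrow_\beta$ on $R$, $\beta\in R$; for $B\subseteq R$ one has a relation $\Longrightarrow_B$, with reflexive symmetric transitive closure $\stackrel{*}{\Longleftrightarrow}_B$. Axioms: (A1) $\Longrightarrow_B=\bigcup_{\beta\in B}\Longrightarrow_\beta$, and $\Longrightarrow_B$ is terminating for every finite $B\subseteq R$. (A2) $\alpha\Longrightarrow_\beta\gamma$ implies $\alpha-\gamma\in\mathrm{ideal}_R(\{\beta\})$. (A3) $\alpha\Longrightarrow_\alpha 0$ for all $\alpha\in R\setminus\{0\}$. A subset $B\subseteq R$ is a Gröbner basis of $\mathfrak i=\mathrm{ideal}_R(B)$ if $\stackrel{*}{\Longleftrightarrow}_B$ equals the congruence modulo $\mathfrak i$ and $\Longrightarrow_B$ is complete (terminating and confluent). $(R,\Longrightarrow)$ satisfying (A1)–(A3) is a reduction ring if every finitely generated ideal has a finite Gröbner basis. A Noetherian reduction ring is a reduction ring whose underlying ring is Noetherian. One-variable extension: in $R[X]$ coefficients commute with $X$. Terms are $X^i$, ordered by exponent; $\operatorname{HT}(f)$, $\operatorname{HC}(f)$ are the leading term and leading coefficient of $f\neq0$. For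 non-zero $p,f\in R[X]$, $f$ reduces $p$ to $q$ at a monomial $\alpha X^i$ of $p$ in one step, $p\longrightarrow_f q$, if (a) $\operatorname{HT}(f)X^j=X^i$ for some $j\ge 0$; (b) $\alpha\Longrightarrow_{\operatorname{HC}(f)}\beta$ with $\alpha=\beta+\sum_{l=1}^m\gamma_l\operatorname{HC}(f)\delta_l$ for some $\beta,\gamma_l,\delta_l\in R$; (c) $q=p-\sum_{l=1}^m(\gamma_l f\delta_l)X^j$. $\longrightarrow_F=\bigcup_{f\in F}\longrightarrow_f$. Iteration: $R[X_1,\dots,X_n]=R[X_1]\cdots[X_n]$, and its reduction relation is obtained by applying the one-variable extension successively: to $(R,\Longrightarrow)$ and $X_1$, then to the resulting ring with reduction relation and $X_2$, and so on. *)

theory Defs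
  imports "HOL-Algebra.Algebra" "HOL-Library.Confluence"
begin

section \<open>Reduction rings\<close>

text \<open>
  A family of relations is a function \<open>red\<close>, where \<open>red \<beta> \<alpha> \<gamma>\<close> stands for
  \<open>\<alpha> \<Longrightarrow>\<^sub>\<beta> \<gamma>\<close>. The relation indexed by a set \<open>B\<close> is the union required by (A1).
\<close>

definition red_set :: "('a \<Rightarrow> 'a \<Rightarrow> 'a \<Rightarrow> bool) \<Rightarrow> 'a set \<Rightarrow> 'a \<Rightarrow> 'a \<Rightarrow> bool" where
  "red_set red B \<alpha> \<gamma> \<longleftrightarrow> (\<exists>\<beta>\<in>B. red \<beta> \<alpha> \<gamma>)"

definition terminating :: "('a \<Rightarrow> 'a \<Rightarrow> bool) \<Rightarrow> bool" where
  "terminating r \<longleftrightarrow> wfp (r\<inverse>\<inverse>)"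

definition complete_red :: "('a \<Rightarrow> 'a \<Rightarrow> bool) \<Rightarrow> bool" where
  "complete_red r \<longleftrightarrow> terminating r \<and> confluentp r"

locale reduction_relation = ring R for R (structure) +
  fixes red :: "'a \<Rightarrow> 'a \<Rightarrow> 'a \<Rightarrow> bool"
  assumes red_closed: "\<lbrakk> \<beta> \<in> carrier R; red \<beta> \<alpha> \<gamma> \<rbrakk> \<Longrightarrow> \<alpha> \<in> carrier R \<and> \<gamma> \<in> carrier R"
    and A1: "\<lbrakk> finite B; B \<subseteq> carrier R \<rbrakk> \<Longrightarrow> terminating (red_set red B)"
    and A2: "\<lbrakk> \<beta> \<in> carrier R; red \<beta> \<alpha> \<gamma> \<rbrakk> \<Longrightarrow> \<alpha> \<ominus> \<gamma> \<in> Idl {\<beta>}"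
    and A3: "\<alpha> \<in> carrier R - {\<zero>} \<Longrightarrow> red \<alpha> \<alpha> \<zero>"

text \<open>
  \<^const>\<open>equivclp\<close> is reflexive on the whole type, so it is compared with the congruence
  on the carrier only.
\<close>

definition groebner_basis ::
  "('a, 'm) ring_scheme \<Rightarrow> ('a \<Rightarrow> 'a \<Rightarrow> 'a \<Rightarrow> bool) \<Rightarrow> 'a set \<Rightarrow> 'a set \<Rightarrow> bool" where
  "groebner_basis R red I B \<longleftrightarrow>
     B \<subseteq> carrier R \<and> I = Idl\<^bsub>R\<^esub> B \<and>
     (\<forall>\<alpha>\<in>carrier R. \<forall>\<gamma>\<in>carrier R. equivclp (red_set red B) \<alpha> \<gamma> \<longleftrightarrow> \<alpha> \<ominus>\<^bsub>R\<^esub> \<gamma> \<in> I) \<and>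
     complete_red (red_set red B)"

locale reduction_ring = reduction_relation +
  assumes finite_groebner_basis:
    "\<lbrakk> finite A; A \<subseteq> carrier R \<rbrakk> \<Longrightarrow> \<exists>B. finite B \<and> groebner_basis R red (Idl A) B"

locale noetherian_reduction_ring = reduction_ring + noetherian_ring


section \<open>The one-variable extension\<close>

text \<open>
  In \<^term>\<open>UP R\<close> coefficients commute with the variable, and \<^const>\<open>UP\<close> does not need \<open>R\<close> to be
  commutative. With \<open>HT(f) = X\<^sup>d\<close>, \<open>d = deg R f\<close>, the condition \<open>HT(f) X\<^sup>j = X\<^sup>i\<close> reads \<open>d + j = i\<close>.
  A monomial of \<open>p\<close> has a non-zero coefficient.
\<close>

definition head_coeff :: "('a, 'm) ring_scheme \<Rightarrow> (nat \<Rightarrow> 'a) \<Rightarrow> 'a" where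
  "head_coeff R f = coeff (UP R) f (deg R f)"

definition poly_red ::
  "('a, 'm) ring_scheme \<Rightarrow> ('a \<Rightarrow> 'a \<Rightarrow> 'a \<Rightarrow> bool) \<Rightarrow>
   (nat \<Rightarrow> 'a) \<Rightarrow> (nat \<Rightarrow> 'a) \<Rightarrow> (nat \<Rightarrow> 'a) \<Rightarrow> bool" where
  "poly_red R red f p q \<longleftrightarrow>
     f \<in> carrier (UP R) - {\<zero>\<^bsub>UP R\<^esub>} \<and> p \<in> carrier (UP R) - {\<zero>\<^bsub>UP R\<^esub>} \<and>
     (\<exists>i j \<alpha> \<beta> m \<gamma> \<delta>.
        \<alpha> = coeff (UP R) p i \<and> \<alpha> \<noteq> \<zero>\<^bsub>R\<^esub> \<and>
        deg R f + j = i \<and>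
        red (head_coeff R f) \<alpha> \<beta> \<and>
        \<beta> \<in> carrier R \<and> \<gamma> \<in> {1..m::nat} \<rightarrow> carrier R \<and> \<delta> \<in> {1..m} \<rightarrow> carrier R \<and>
        \<alpha> = \<beta> \<oplus>\<^bsub>R\<^esub> (\<Oplus>\<^bsub>R\<^esub>l\<in>{1..m}. \<gamma> l \<otimes>\<^bsub>R\<^esub> head_coeff R f \<otimes>\<^bsub>R\<^esub> \<delta> l) \<and>
        q = p \<ominus>\<^bsub>UP R\<^esub>
              (\<Oplus>\<^bsub>UP R\<^esub>l\<in>{1..m}. monom (UP R) (\<gamma> l) 0 \<otimes>\<^bsub>UP R\<^esub> f \<otimes>\<^bsub>UP R\<^esub> monom (UP R) (\<delta> l) 0)
                \<otimes>\<^bsub>UP R\<^esub> monom (UP R) \<one>\<^bsub>R\<^esub> j)"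


section \<open>Iteration\<close>

text \<open>
  Each application of \<^const>\<open>UP\<close> changes the type from \<open>'a\<close> to \<open>nat \<Rightarrow> 'a\<close>. To iterate it \<open>n\<close> times
  for a variable \<open>n\<close>, all the rings are placed in one type: \<open>Coeff\<close> embeds \<open>R\<close>, and \<open>Poly\<close> embeds
  the polynomials over a ring that is already there. Both are injective, so \<^const>\<open>image_ring\<close>
  only renames elements: \<^term>\<open>image_ring Coeff R\<close> is a copy of \<open>R\<close> and
  \<^term>\<open>image_ring Poly (UP S)\<close> is a copy of \<open>S[X]\<close>.
\<close>

datatype 'a tower = Coeff 'a | Poly "nat \<Rightarrow> 'a tower"

definition image_red ::
  "('a \<Rightarrow> 'b) \<Rightarrow> ('a \<Rightarrow> 'a \<Rightarrow> 'a \<Rightarrow> bool) \<Rightarrow> 'b \<Rightarrow> 'b \<Rightarrow> 'b \<Rightarrow> bool" where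
  "image_red h red b a c \<longleftrightarrow> (\<exists>\<beta> \<alpha> \<gamma>. b = h \<beta> \<and> a = h \<alpha> \<and> c = h \<gamma> \<and> red \<beta> \<alpha> \<gamma>)"

primrec iter_poly_ring :: "('a, 'm) ring_scheme \<Rightarrow> nat \<Rightarrow> 'a tower ring" where
  "iter_poly_ring R 0 = image_ring Coeff R"
| "iter_poly_ring R (Suc n) = image_ring Poly (UP (iter_poly_ring R n))"

primrec iter_poly_red ::
  "('a, 'm) ring_scheme \<Rightarrow> ('a \<Rightarrow> 'a \<Rightarrow> 'a \<Rightarrow> bool) \<Rightarrow> nat \<Rightarrow> 'a tower \<Rightarrow> 'a tower \<Rightarrow> 'a tower \<Rightarrow> bool" where
  "iter_poly_red R red 0 = image_red Coeff red"
| "iter_poly_red R red (Suc n) =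
     image_red Poly (poly_red (iter_poly_ring R n) (iter_poly_red R red n))"

end

theory Submission
  imports Defs
begin

text \<open>
  A finite \<open>B \<subseteq> J\<close> is a Groebner basis of the ideal \<open>J\<close> iff any two irreducible elements that are
  congruent modulo \<open>J\<close> are equal. Given an ideal \<open>J\<close> of \<open>R[X]\<close>, let \<open>L\<^sub>n\<close> be the ideal of the
  coefficients of \<open>X\<^sup>n\<close> in the elements of \<open>J\<close> of degree at most \<open>n\<close>. The chain of the \<open>L\<^sub>n\<close> is
  constant from some \<open>N\<close> on. For every \<open>n \<le> N\<close> and every non-zero \<open>g\<close> in a finite Groebner basis of
  \<open>L\<^sub>n\<close> choose a polynomial in \<open>J\<close> with leading monomial \<open>g X\<^sup>n\<close>. With respect to this finite set the
  coefficient of \<open>X\<^sup>i\<close> in an irreducible polynomial is irreducible modulo the Groebner basis of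
  \<open>L\<^sub>m\<close>, \<open>m = min(i, N)\<close>. If two irreducible polynomials are congruent modulo \<open>J\<close>, the highest
  coefficients in which they differ are irreducible and congruent modulo \<open>L\<^sub>i = L\<^sub>m\<close>, hence equal. This
  shows at once that every ideal of \<open>R[X]\<close> is finitely generated and has a finite Groebner basis.
\<close>


section \<open>Terminating relations\<close>

lemma terminating_iff_no_chain: "terminating r \<longleftrightarrow> (\<nexists>f. \<forall>i::nat. r (f i) (f (Suc i)))"
  unfolding terminating_def wfp_def wf_iff_no_infinite_down_chain by simp

lemma terminatingD: "\<lbrakk> terminating r; \<And>i::nat. r (f i) (f (Suc i)) \<rbrakk> \<Longrightarrow> False"
  unfolding terminating_iff_no_chain by blast

lemma terminating_normal_form:
  assumes "terminating r"
  shows "\<exists>b. r\<^sup>*\<^sup>* a b \<and> (\<nexists>c. r b c)"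
proof -
  have "wfp (r\<inverse>\<inverse>)" using assms by (simp add: terminating_def)
  then show ?thesis
  proof (induction a rule: wfp_induct_rule)
    case (less a)
    then show ?case by (metis conversep_iff converse_rtranclp_into_rtranclp rtranclp.rtrancl_refl)
  qed
qed


section \<open>Groebner bases and normal forms\<close>

text \<open>For a finite subset of an ideal this stands in for the Groebner property. It speaks of
  irreducible elements of the carrier only, with no confluence or equivalence closure, and in this
  form the property passes between a ring, its renamed copies and its polynomials.\<close>

definition separates_normal_forms ::
  "('a, 'm) ring_scheme \<Rightarrow> ('a \<Rightarrow> 'a \<Rightarrow> 'a \<Rightarrow> bool) \<Rightarrow> 'a set \<Rightarrow> 'a set \<Rightarrow> bool" where
  "separates_normal_forms R red J B \<longleftrightarrow>
     (\<forall>a\<in>carrier R. \<forall>b\<in>carrier R.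
        (\<nexists>c. red_set red B a c) \<longrightarrow> (\<nexists>c. red_set red B b c) \<longrightarrow> a \<ominus>\<^bsub>R\<^esub> b \<in> J \<longrightarrow> a = b)"

context reduction_relation
begin

text \<open>A loop would repeat to an infinite chain, against (A1) for a singleton.\<close>

lemma red_irrefl: "\<beta> \<in> carrier R \<Longrightarrow> \<not> red \<beta> \<alpha> \<alpha>"
  using A1[of "{\<beta>}"] unfolding terminating_iff_no_chain red_set_def by auto

text \<open>By (A2) such a step would change nothing, hence be a loop. This permits dropping 0 from
  a set of reducers.\<close>

lemma red_zero_index: "\<not> red \<zero> \<alpha> \<gamma>"
proof
  assume r: "red \<zero> \<alpha> \<gamma>"
  have "\<alpha> \<ominus> \<gamma> = \<zero>" using A2[OF _ r] by (simp add: genideal_zero)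
  then have "\<alpha> = \<gamma>" using red_closed[OF _ r] by simp
  then show False using red_irrefl r by blast
qed

text \<open>If \<open>\<beta>\<close> took \<open>\<zero>\<close> to some \<open>\<gamma>\<close>,
  then \<open>\<gamma>\<close> would be non-zero and (A3) would take it back to
  \<open>\<zero>\<close>: an endless alternation under the finite set
  \<open>{\<beta>, \<gamma>}\<close>.\<close>

lemma zero_irreducible:
  assumes "\<beta> \<in> carrier R" shows "\<not> red \<beta> \<zero> \<gamma>"
proof
  assume r: "red \<beta> \<zero> \<gamma>"
  have g: "\<gamma> \<in> carrier R" using red_closed[OF assms r] by simp
  have "\<gamma> \<noteq> \<zero>" using red_irrefl[OF assms] r by blast
  then have r': "red \<gamma> \<gamma> \<zero>" using A3 g by simp
  have "terminating (red_set red {\<beta>, \<gamma>})" using A1 assms g by simp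
  then show False
    by (rule terminatingD[where f = "\<lambda>i. if even i then \<zero> else \<gamma>"]) (use r r' in \<open>auto simp: red_set_def\<close>)
qed

lemma red_set_step:
  assumes "ideal J R" "B \<subseteq> J" "red_set red B a b"
  shows "a \<in> carrier R" "b \<in> carrier R" "a \<ominus> b \<in> J"
proof -
  interpret J: ideal J R by fact
  obtain \<beta> where b: "\<beta> \<in> B" "red \<beta> a b" using assms(3) by (auto simp: red_set_def)
  then have bc: "\<beta> \<in> carrier R" using assms(2) J.a_subset by blast
  show "a \<in> carrier R" "b \<in> carrier R" using red_closed[OF bc b(2)] by auto
  have "Idl {\<beta>} \<subseteq> J" using genideal_minimal[OF assms(1)] b(1) assms(2) by blast
  then show "a \<ominus> b \<in> J" using A2[OF bc b(2)] by blast
qed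

lemma minus_in_ideal_sym:
  assumes "ideal J R" "a \<in> carrier R" "b \<in> carrier R" "a \<ominus> b \<in> J"
  shows "b \<ominus> a \<in> J"
proof -
  interpret J: ideal J R by fact
  have "b \<ominus> a = \<ominus> (a \<ominus> b)" using assms by (simp add: a_minus_def minus_add a_comm)
  then show ?thesis using J.a_inv_closed[OF assms(4)] by simp
qed

lemma minus_in_ideal_trans:
  assumes "ideal J R" "a \<in> carrier R" "b \<in> carrier R" "c \<in> carrier R" "a \<ominus> b \<in> J" "b \<ominus> c \<in> J"
  shows "a \<ominus> c \<in> J"
proof -
  interpret J: ideal J R by fact
  have "a \<ominus> c = (a \<ominus> b) \<oplus> (b \<ominus> c)"
    using assms(2-4) by (simp add: a_minus_def a_assoc r_neg1 r_neg2 l_neg)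
  then show ?thesis using J.a_closed[OF assms(5,6)] by simp
qed

text \<open>The ideal may be any one containing \<open>B\<close>; both \<open>J\<close> and
  \<open>Idl B\<close> are inserted below.\<close>

lemma equivclp_minus_in_ideal:
  assumes "ideal J R" "B \<subseteq> J" "a \<in> carrier R" "equivclp (red_set red B) a b"
  shows "b \<in> carrier R \<and> a \<ominus> b \<in> J"
  using assms(4)
proof (induction rule: equivclp_induct)
  case base
  interpret J: ideal J R by fact
  show ?case using assms(3) by (simp add: a_minus_def r_neg)
next
  case (step y z)
  then have "z \<in> carrier R \<and> y \<ominus> z \<in> J"
    using red_set_step[OF assms(1,2)] minus_in_ideal_sym[OF assms(1)] by blast
  then show ?case using minus_in_ideal_trans[OF assms(1,3)] step.IH by blast
qed

lemma rtranclp_minus_in_ideal: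
  assumes "ideal J R" "B \<subseteq> J" "a \<in> carrier R" "(red_set red B)\<^sup>*\<^sup>* a b"
  shows "b \<in> carrier R \<and> a \<ominus> b \<in> J"
  using assms(4) by (intro equivclp_minus_in_ideal[OF assms(1-3)]) (rule rtranclp_into_equivclp)

text \<open>Normal forms of congruent elements are irreducible and congruent, hence equal. So
  congruent elements have a common reduct, which yields confluence, the inclusion of the congruence
  in the equivalence closure, and \<open>J = Idl B\<close>.\<close>

lemma groebner_basis_if_separates:
  assumes J: "ideal J R" and B: "finite B" "B \<subseteq> J" and sep: "separates_normal_forms R red J B"
  shows "groebner_basis R red J B"
proof -
  interpret J: ideal J R by fact
  let ?r = "red_set red B"
  have Bc: "B \<subseteq> carrier R" using B(2) J.a_subset by blast
  have term_r: "terminating ?r" using A1 B(1) Bc by blast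
  have uniq: "c = d" if "a \<in> carrier R" "b \<in> carrier R" "a \<ominus> b \<in> J"
    "?r\<^sup>*\<^sup>* a c" "\<nexists>x. ?r c x" "?r\<^sup>*\<^sup>* b d" "\<nexists>x. ?r d x" for a b c d
  proof -
    note c = rtranclp_minus_in_ideal[OF J B(2) that(1,4)]
    note d = rtranclp_minus_in_ideal[OF J B(2) that(2,6)]
    have "c \<ominus> b \<in> J"
      using minus_in_ideal_trans[OF J _ that(1,2) minus_in_ideal_sym[OF J that(1)] that(3)] c by blast
    then have "c \<ominus> d \<in> J" using minus_in_ideal_trans[OF J _ that(2)] c d by blast
    then show ?thesis using sep that(5,7) c d unfolding separates_normal_forms_def by blast
  qed
  have join: "\<exists>c. ?r\<^sup>*\<^sup>* a c \<and> ?r\<^sup>*\<^sup>* b c" if "a \<in> carrier R" "b \<in> carrier R" "a \<ominus> b \<in> J" for a b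
    using uniq[OF that] terminating_normal_form[OF term_r, of a]
      terminating_normal_form[OF term_r, of b] by blast
  have "confluentp ?r"
  proof (rule confluentpI)
    fix x y z assume xy: "?r\<^sup>*\<^sup>* x y" and xz: "?r\<^sup>*\<^sup>* x z"
    show "\<exists>u. ?r\<^sup>*\<^sup>* y u \<and> ?r\<^sup>*\<^sup>* z u"
    proof (cases "x \<in> carrier R")
      case True
      note y = rtranclp_minus_in_ideal[OF J B(2) True xy]
      note z = rtranclp_minus_in_ideal[OF J B(2) True xz]
      have "y \<ominus> z \<in> J"
        using minus_in_ideal_trans[OF J _ True _ minus_in_ideal_sym[OF J True]] y z by blast
      then show ?thesis using join y z by blast
    next
      \<comment> \<open>Confluence is asked on the whole type, but no step starts outside the
        carrier.\<close>
      case False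
      then have "y = x" "z = x"
        using xy xz red_set_step(1)[OF J B(2)] by (auto elim: converse_rtranclpE)
      then show ?thesis by blast
    qed
  qed
  have equiv: "equivclp ?r a b" if "a \<in> carrier R" "b \<in> carrier R" "a \<ominus> b \<in> J" for a b
    using join[OF that] by (meson equivclp_sym equivclp_trans rtranclp_into_equivclp)
  have "J \<subseteq> Idl B"
  proof
    fix a assume a: "a \<in> J"
    then have ac: "a \<in> carrier R" by (rule J.Icarr)
    \<comment> \<open>Elements of \<open>J\<close> are congruent to \<open>\<zero>\<close>, hence
      linked to it by steps; each of these changes an element by a member of
      \<open>Idl B\<close>.\<close>
    have "equivclp ?r a \<zero>" using equiv[OF ac] a ac by (simp add: a_minus_def)
    then have "a \<ominus> \<zero> \<in> Idl B"
      using equivclp_minus_in_ideal[OF genideal_ideal[OF Bc] genideal_self[OF Bc] ac] by blast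
    then show "a \<in> Idl B" using ac by (simp add: a_minus_def)
  qed
  then have "J = Idl B" using genideal_minimal[OF J B(2)] by blast
  then show ?thesis
    unfolding groebner_basis_def complete_red_def
    using equivclp_minus_in_ideal[OF J B(2)] equiv Bc term_r \<open>confluentp ?r\<close> by blast
qed

text \<open>Congruent elements are equivalent and, by confluence, have a common reduct; an
  irreducible element has no reduct but itself.\<close>

lemma separates_if_groebner_basis:
  assumes "groebner_basis R red J B"
  shows "separates_normal_forms R red J B"
  unfolding separates_normal_forms_def
proof (intro ballI impI)
  let ?r = "red_set red B"
  fix a b assume ab: "a \<in> carrier R" "b \<in> carrier R" "\<nexists>c. ?r a c" "\<nexists>c. ?r b c" "a \<ominus> b \<in> J"
  then have "equivclp ?r a b" "semiconfluentp ?r"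
    using assms unfolding groebner_basis_def complete_red_def
    by (auto intro: confluentp_imp_semiconfluentp)
  then obtain c where "?r\<^sup>*\<^sup>* a c" "?r\<^sup>*\<^sup>* b c"
    by (auto simp: semiconfluentp_equivclp rtranclp_conversep)
  then show "a = b" using ab(3,4) by (metis converse_rtranclpE)
qed

text \<open>Since \<open>J\<close> runs through all ideals, the finite Groebner bases also serve as
  finite generating sets.\<close>

lemma noetherian_reduction_ringI:
  assumes "\<And>J. ideal J R \<Longrightarrow> \<exists>B. finite B \<and> B \<subseteq> J \<and> separates_normal_forms R red J B"
  shows "noetherian_reduction_ring R red"
proof -
  have gb: "\<exists>B. finite B \<and> groebner_basis R red J B" if "ideal J R" for J
    using assms[OF that] groebner_basis_if_separates[OF that] by blast
  show ?thesis
  proof unfold_locales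
    fix A assume "finite A" "A \<subseteq> carrier R"
    then show "\<exists>B. finite B \<and> groebner_basis R red (Idl A) B" by (intro gb genideal_ideal)
  next
    fix J assume "ideal J R"
    then show "\<exists>A\<subseteq>carrier R. finite A \<and> J = Idl A"
      using gb unfolding groebner_basis_def by blast
  qed
qed

end

text \<open>Finite generation makes the Groebner basis axiom apply to every ideal.\<close>

lemma (in noetherian_reduction_ring) ex_separating_set:
  assumes "ideal J R"
  shows "\<exists>B. finite B \<and> B \<subseteq> J \<and> separates_normal_forms R red J B"
proof -
  obtain A where "A \<subseteq> carrier R" "finite A" "J = Idl A" using finetely_gen[OF assms] by blast
  then obtain B where B: "finite B" "groebner_basis R red J B" using finite_groebner_basis by blast
  then have "B \<subseteq> J" unfolding groebner_basis_def using genideal_self by blast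
  then show ?thesis using B separates_if_groebner_basis by blast
qed


section \<open>Transport along an injection\<close>

text \<open>\<open>image_red\<close> draws preimages from the whole type, so injectivity on the
  whole type is what makes steps in the copy come from steps in \<open>R\<close>.\<close>

lemma noetherian_reduction_ring_image:
  assumes "noetherian_reduction_ring R red" and inj: "inj h"
  shows "noetherian_reduction_ring (image_ring h R) (image_red h red)"
proof -
  interpret R: noetherian_reduction_ring R red by fact
  let ?S = "image_ring h R"
  have iso: "h \<in> ring_iso R ?S"
    using inj_imp_image_ring_iso inj_on_subset[OF inj] by blast
  interpret S: ring ?S
    using R.inj_imp_image_ring_is_ring inj_on_subset[OF inj] by blast
  interpret h: ring_hom_ring R ?S h
    using iso by unfold_locales (simp add: ring_iso_def)
  note carr = image_ring_carrier[of h R]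
  have image_red_iff: "image_red h red (h b) (h a) c \<longleftrightarrow> (\<exists>d. c = h d \<and> red b a d)" for a b c
    using inj unfolding image_red_def by (auto simp: inj_eq)
  have red_set_iff: "red_set (image_red h red) (h ` B) (h a) c \<longleftrightarrow> (\<exists>d. c = h d \<and> red_set red B a d)"
    for B a c unfolding red_set_def by (auto simp: image_red_iff)
  interpret S: reduction_relation ?S "image_red h red"
  proof unfold_locales
    fix b a c assume "b \<in> carrier ?S" "image_red h red b a c"
    then show "a \<in> carrier ?S \<and> c \<in> carrier ?S"
      unfolding carr image_red_def by (auto simp: inj_eq[OF inj] dest: R.red_closed)
  next
    fix B assume fin: "finite B" "B \<subseteq> carrier ?S"
    then obtain A where A: "finite A" "A \<subseteq> carrier R" "B = h ` A"
      unfolding carr by (meson finite_subset_image)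
    show "terminating (red_set (image_red h red) B)"
      unfolding terminating_iff_no_chain
    proof
      assume "\<exists>f. \<forall>i::nat. red_set (image_red h red) B (f i) (f (Suc i))"
      then obtain f where f: "\<And>i::nat. red_set (image_red h red) B (f i) (f (Suc i))" by blast
      \<comment> \<open>Each member of the chain is the source of a step and so lies in the range of
        \<open>h\<close>; the whole chain pulls back to \<open>R\<close>.\<close>
      have f_eq: "f i = h (inv_into UNIV h (f i))" for i
      proof -
        have "f i \<in> range h" using f[of i] unfolding red_set_def image_red_def by auto
        then show ?thesis by (simp add: f_inv_into_f)
      qed
      have "red_set red A (inv_into UNIV h (f i)) (inv_into UNIV h (f (Suc i)))" for i
        using f[of i] A(3) red_set_iff[of A "inv_into UNIV h (f i)" "f (Suc i)"] f_eq[of i] inj by auto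
      then show False
        using R.A1[OF A(1,2)] by (rule terminatingD[rotated])
    qed
  next
    fix b a c assume b: "b \<in> carrier ?S" and r: "image_red h red b a c"
    then obtain b' a' c' where e: "b' \<in> carrier R" "b = h b'" "a = h a'" "c = h c'" "red b' a' c'"
      unfolding carr image_red_def by (auto simp: inj_eq[OF inj])
    have ac: "a' \<in> carrier R" "c' \<in> carrier R" using R.red_closed[OF e(1,5)] by auto
    \<comment> \<open>The preimage of this ideal is an ideal of \<open>R\<close> containing
      \<open>b'\<close>, hence it contains the differences provided by (A2) in
      \<open>R\<close>.\<close>
    have I: "ideal (Idl\<^bsub>?S\<^esub> {b}) ?S" using b by (intro S.genideal_ideal) simp
    have "Idl\<^bsub>R\<^esub> {b'} \<subseteq> {x \<in> carrier R. h x \<in> Idl\<^bsub>?S\<^esub> {b}}"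
      using S.genideal_self'[OF b] e by (intro R.genideal_minimal h.ideal_vimage I) simp
    then have "h (a' \<ominus>\<^bsub>R\<^esub> c') \<in> Idl\<^bsub>?S\<^esub> {b}" using R.A2[OF e(1,5)] by blast
    then show "a \<ominus>\<^bsub>?S\<^esub> c \<in> Idl\<^bsub>?S\<^esub> {b}" using e ac by (simp add: a_minus_def)
  next
    fix a assume "a \<in> carrier ?S - {\<zero>\<^bsub>?S\<^esub>}"
    then show "image_red h red a a \<zero>\<^bsub>?S\<^esub>"
      unfolding carr image_ring_zero by (auto simp: image_red_iff simp del: h.hom_zero intro!: R.A3)
  qed
  show ?thesis
  proof (rule S.noetherian_reduction_ringI)
    fix J assume J: "ideal J ?S"
    \<comment> \<open>A separating set for the preimage of \<open>J\<close> is pushed forward along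
      \<open>h\<close>.\<close>
    let ?I = "{x \<in> carrier R. h x \<in> J}"
    obtain B where B: "finite B" "B \<subseteq> ?I" "separates_normal_forms R red ?I B"
      using R.ex_separating_set[OF h.ideal_vimage[OF J]] by blast
    have "separates_normal_forms ?S (image_red h red) J (h ` B)"
      unfolding separates_normal_forms_def carr
    proof (intro ballI impI)
      fix a b assume "a \<in> h ` carrier R" "b \<in> h ` carrier R"
        and n: "\<nexists>c. red_set (image_red h red) (h ` B) a c" "\<nexists>c. red_set (image_red h red) (h ` B) b c"
        and m: "a \<ominus>\<^bsub>?S\<^esub> b \<in> J"
      then obtain x y where x: "x \<in> carrier R" "a = h x" and y: "y \<in> carrier R" "b = h y" by blast
      have "x \<ominus>\<^bsub>R\<^esub> y \<in> ?I" using m x y by (simp add: a_minus_def)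
      then show "a = b"
        using B(3) n x y unfolding separates_normal_forms_def by (auto simp: red_set_iff)
    qed
    then show "\<exists>B. finite B \<and> B \<subseteq> J \<and> separates_normal_forms ?S (image_red h red) J B"
      using B(1,2) by (intro exI[of _ "h ` B"]) auto
  qed
qed


section \<open>Ideals generated by one element\<close>

lemma (in ideal) finsum_in_ideal:
  assumes "finite A" "f \<in> A \<rightarrow> I"
  shows "(\<Oplus>x\<in>A. f x) \<in> I"
  using assms
proof (induction A rule: finite_induct)
  case empty
  show ?case by simp
next
  case (insert x A)
  moreover from insert have "f \<in> A \<rightarrow> carrier R" "f x \<in> carrier R" by (auto dest: Icarr)
  ultimately show ?case by (auto intro: a_closed)
qed

lemma (in abelian_monoid) finsum_atLeast1_Suc:
  assumes "f \<in> {1..Suc k} \<rightarrow> carrier G"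
  shows "(\<Oplus>l\<in>{1..Suc k}. f l) = f (Suc k) \<oplus> (\<Oplus>l\<in>{1..k}. f l)"
proof -
  have "{1..Suc k} = insert (Suc k) {1..k}" by auto
  then show ?thesis using assms by (simp add: Pi_iff)
qed

text \<open>These sums describe the two-sided principal ideal of \<open>a\<close>; several summands
  are allowed because the ring may be noncommutative. The index set \<open>{1..m}\<close> matches
  \<open>poly_red\<close>.\<close>

definition (in ring) two_sided_sums :: "'a \<Rightarrow> 'a set" where
  "two_sided_sums a = {x. \<exists>m \<gamma> \<delta>. \<gamma> \<in> {1..m::nat} \<rightarrow> carrier R \<and> \<delta> \<in> {1..m} \<rightarrow> carrier R \<and>
     x = (\<Oplus>l\<in>{1..m}. \<gamma> l \<otimes> a \<otimes> \<delta> l)}"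

context ring
begin

lemma two_sided_sums_add_one:
  assumes a: "a \<in> carrier R" and x: "x \<in> two_sided_sums a" and c: "c \<in> carrier R" "d \<in> carrier R"
  shows "x \<oplus> c \<otimes> a \<otimes> d \<in> two_sided_sums a"
proof -
  obtain m \<gamma> \<delta> where g: "\<gamma> \<in> {1..m::nat} \<rightarrow> carrier R" "\<delta> \<in> {1..m} \<rightarrow> carrier R"
    "x = (\<Oplus>l\<in>{1..m}. \<gamma> l \<otimes> a \<otimes> \<delta> l)" using x unfolding two_sided_sums_def by blast
  let ?g = "\<gamma>(Suc m := c)" and ?d = "\<delta>(Suc m := d)"
  have "(\<Oplus>l\<in>{1..m}. ?g l \<otimes> a \<otimes> ?d l) = x"
    unfolding g(3) using g(1,2) a by (intro finsum_cong') auto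
  moreover have "(\<Oplus>l\<in>{1..Suc m}. ?g l \<otimes> a \<otimes> ?d l)
      = c \<otimes> a \<otimes> d \<oplus> (\<Oplus>l\<in>{1..m}. ?g l \<otimes> a \<otimes> ?d l)"
    using g(1,2) a c by (subst finsum_atLeast1_Suc) (auto simp: Pi_iff)
  moreover have "x \<in> carrier R" unfolding g(3) using g(1,2) a by (intro finsum_closed) auto
  ultimately have "x \<oplus> c \<otimes> a \<otimes> d = (\<Oplus>l\<in>{1..Suc m}. ?g l \<otimes> a \<otimes> ?d l)"
    using a c by (simp add: a_comm)
  moreover have "?g \<in> {1..Suc m} \<rightarrow> carrier R" "?d \<in> {1..Suc m} \<rightarrow> carrier R" using g c by auto
  ultimately show ?thesis unfolding two_sided_sums_def by blast
qed

lemma two_sided_sums_carrier: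
  assumes "a \<in> carrier R" "x \<in> two_sided_sums a" shows "x \<in> carrier R"
  using assms unfolding two_sided_sums_def by (auto intro!: finsum_closed)

lemma zero_two_sided_sums: "\<zero> \<in> two_sided_sums a"
  unfolding two_sided_sums_def by (auto intro!: exI[of _ 0])

text \<open>The summands of \<open>y\<close> are appended to \<open>x\<close> one at a time, which
  avoids concatenating the families.\<close>

lemma two_sided_sums_add:
  assumes a: "a \<in> carrier R" and x: "x \<in> two_sided_sums a" and y: "y \<in> two_sided_sums a"
  shows "x \<oplus> y \<in> two_sided_sums a"
proof -
  obtain m \<gamma> \<delta> where g: "\<gamma> \<in> {1..m::nat} \<rightarrow> carrier R" "\<delta> \<in> {1..m} \<rightarrow> carrier R"
    "y = (\<Oplus>l\<in>{1..m}. \<gamma> l \<otimes> a \<otimes> \<delta> l)" using y unfolding two_sided_sums_def by blast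
  have xc: "x \<in> carrier R" using two_sided_sums_carrier a x by blast
  have "k \<le> m \<Longrightarrow> x \<oplus> (\<Oplus>l\<in>{1..k}. \<gamma> l \<otimes> a \<otimes> \<delta> l) \<in> two_sided_sums a" for k
  proof (induction k)
    case 0
    then show ?case using x xc by simp
  next
    case (Suc k)
    have gc: "\<gamma> (Suc k) \<in> carrier R" "\<delta> (Suc k) \<in> carrier R" using Suc.prems g(1,2) by auto
    have tc: "(\<lambda>l. \<gamma> l \<otimes> a \<otimes> \<delta> l) \<in> {1..Suc k} \<rightarrow> carrier R"
      using Suc.prems g(1,2) a by (auto simp: Pi_iff)
    then have sc: "(\<Oplus>l\<in>{1..k}. \<gamma> l \<otimes> a \<otimes> \<delta> l) \<in> carrier R" by (intro finsum_closed) auto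
    have "(\<Oplus>l\<in>{1..Suc k}. \<gamma> l \<otimes> a \<otimes> \<delta> l)
        = \<gamma> (Suc k) \<otimes> a \<otimes> \<delta> (Suc k) \<oplus> (\<Oplus>l\<in>{1..k}. \<gamma> l \<otimes> a \<otimes> \<delta> l)"
      by (rule finsum_atLeast1_Suc[OF tc])
    then have "x \<oplus> (\<Oplus>l\<in>{1..Suc k}. \<gamma> l \<otimes> a \<otimes> \<delta> l)
        = x \<oplus> (\<Oplus>l\<in>{1..k}. \<gamma> l \<otimes> a \<otimes> \<delta> l) \<oplus> \<gamma> (Suc k) \<otimes> a \<otimes> \<delta> (Suc k)"
      using xc gc a sc by (simp add: a_assoc a_comm[of "\<gamma> (Suc k) \<otimes> a \<otimes> \<delta> (Suc k)"])
    then show ?case using two_sided_sums_add_one[OF a Suc.IH gc] Suc.prems by simp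
  qed
  then show ?thesis using g(3) by blast
qed

lemma two_sided_sums_mult:
  assumes a: "a \<in> carrier R" and x: "x \<in> two_sided_sums a" and r: "r \<in> carrier R"
  shows "r \<otimes> x \<in> two_sided_sums a" "x \<otimes> r \<in> two_sided_sums a"
proof -
  obtain m \<gamma> \<delta> where g: "\<gamma> \<in> {1..m::nat} \<rightarrow> carrier R" "\<delta> \<in> {1..m} \<rightarrow> carrier R"
    "x = (\<Oplus>l\<in>{1..m}. \<gamma> l \<otimes> a \<otimes> \<delta> l)" using x unfolding two_sided_sums_def by blast
  have tc: "(\<lambda>l. \<gamma> l \<otimes> a \<otimes> \<delta> l) \<in> {1..m} \<rightarrow> carrier R" using g a by auto
  have "r \<otimes> x = (\<Oplus>l\<in>{1..m}. r \<otimes> (\<gamma> l \<otimes> a \<otimes> \<delta> l))"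
    unfolding g(3) using r tc by (simp add: finsum_rdistr)
  also have "\<dots> = (\<Oplus>l\<in>{1..m}. (r \<otimes> \<gamma> l) \<otimes> a \<otimes> \<delta> l)"
    using r a g(1,2) by (intro finsum_cong') (auto simp: m_assoc Pi_iff)
  finally show "r \<otimes> x \<in> two_sided_sums a"
    using r g(1,2) unfolding two_sided_sums_def mem_Collect_eq
    by (intro exI[of _ m] exI[of _ "\<lambda>l. r \<otimes> \<gamma> l"] exI[of _ \<delta>]) auto
  have "x \<otimes> r = (\<Oplus>l\<in>{1..m}. (\<gamma> l \<otimes> a \<otimes> \<delta> l) \<otimes> r)"
    unfolding g(3) using r tc by (simp add: finsum_ldistr)
  also have "\<dots> = (\<Oplus>l\<in>{1..m}. \<gamma> l \<otimes> a \<otimes> (\<delta> l \<otimes> r))"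
    using r a g(1,2) by (intro finsum_cong') (auto simp: m_assoc Pi_iff)
  finally show "x \<otimes> r \<in> two_sided_sums a"
    using r g(1,2) unfolding two_sided_sums_def mem_Collect_eq
    by (intro exI[of _ m] exI[of _ \<gamma>] exI[of _ "\<lambda>l. \<delta> l \<otimes> r"]) auto
qed

text \<open>Negatives arise as multiples by \<open>\<ominus> \<one>\<close>.\<close>

lemma idealI_mult_closed:
  assumes "I \<subseteq> carrier R" "\<zero> \<in> I" "\<And>x y. \<lbrakk>x \<in> I; y \<in> I\<rbrakk> \<Longrightarrow> x \<oplus> y \<in> I"
    "\<And>x r. \<lbrakk>x \<in> I; r \<in> carrier R\<rbrakk> \<Longrightarrow> r \<otimes> x \<in> I"
    "\<And>x r. \<lbrakk>x \<in> I; r \<in> carrier R\<rbrakk> \<Longrightarrow> x \<otimes> r \<in> I"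
  shows "ideal I R"
proof (rule idealI[OF ring_axioms])
  have "\<ominus> x \<in> I" if "x \<in> I" for x
    using assms(4)[OF that, of "\<ominus> \<one>"] that assms(1) by (auto simp: l_minus)
  then show "subgroup I (add_monoid R)"
    using assms(1-3) by (intro add.subgroupI) (auto simp: a_inv_def)
qed (use assms in auto)

lemma ideal_two_sided_sums: "a \<in> carrier R \<Longrightarrow> ideal (two_sided_sums a) R"
  using two_sided_sums_carrier zero_two_sided_sums two_sided_sums_add two_sided_sums_mult
  by (intro idealI_mult_closed) auto

text \<open>The sums form an ideal, and \<open>a\<close> is the one-term sum with both factors
  \<open>\<one>\<close>. Combined with (A2), this produces the decomposition of a coefficient
  demanded by \<open>poly_red\<close>.\<close>

lemma Idl_singleton_subset: "a \<in> carrier R \<Longrightarrow> Idl {a} \<subseteq> two_sided_sums a"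
  using two_sided_sums_add_one[OF _ zero_two_sided_sums, of a \<one> \<one>]
  by (intro genideal_minimal ideal_two_sided_sums) auto

end


section \<open>Polynomials over a reduction ring\<close>

text \<open>
  In the scope of the ring \<open>P\<close> the bare names \<open>coeff\<close> and \<open>monom\<close> denote operations on the list
  polynomials of HOL-Algebra; hence \<open>up_ring.coeff\<close> and \<open>up_ring.monom\<close>.
\<close>

context UP_ring
begin

lemma coeff_minus:
  "\<lbrakk> p \<in> carrier P; q \<in> carrier P \<rbrakk> \<Longrightarrow> up_ring.coeff P (p \<ominus>\<^bsub>P\<^esub> q) n = up_ring.coeff P p n \<ominus> up_ring.coeff P q n"
  by (simp add: a_minus_def)

lemma coeff_finsum:
  assumes "finite A" "f \<in> A \<rightarrow> carrier P"
  shows "up_ring.coeff P (\<Oplus>\<^bsub>P\<^esub>x\<in>A. f x) n = (\<Oplus>x\<in>A. up_ring.coeff P (f x) n)"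
  using assms by (induction A rule: finite_induct) (auto simp: Pi_iff)

text \<open>Only the summand at index \<open>n - j\<close> of the convolution survives.\<close>

lemma coeff_mult_monom:
  assumes p: "p \<in> carrier P" and b: "b \<in> carrier R"
  shows "up_ring.coeff P (p \<otimes>\<^bsub>P\<^esub> up_ring.monom P b j) n = (if j \<le> n then up_ring.coeff P p (n - j) \<otimes> b else \<zero>)"
proof (cases "j \<le> n")
  case True
  have "up_ring.coeff P (p \<otimes>\<^bsub>P\<^esub> up_ring.monom P b j) n
      = (\<Oplus>i\<in>{..n}. if n - j = i then up_ring.coeff P p i \<otimes> b else \<zero>)"
    using assms True by (auto intro!: R.finsum_cong')
  also have "\<dots> = up_ring.coeff P p (n - j) \<otimes> b"
    using assms by (intro R.finsum_singleton) auto
  finally show ?thesis using True by simp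
next
  case False
  have "up_ring.coeff P (p \<otimes>\<^bsub>P\<^esub> up_ring.monom P b j) n = (\<Oplus>i\<in>{..n}. \<zero>)"
    unfolding coeff_mult[OF p monom_closed[OF b]]
    using assms False by (intro R.finsum_cong') auto
  then show ?thesis using False by simp
qed

section \<open>The polynomial subtracted in a reduction step\<close>

definition shifted_sum :: "(nat \<Rightarrow> 'a) \<Rightarrow> nat \<Rightarrow> (nat \<Rightarrow> 'a) \<Rightarrow> (nat \<Rightarrow> 'a) \<Rightarrow> nat \<Rightarrow> nat \<Rightarrow> 'a" where
  "shifted_sum f m \<gamma> \<delta> j =
     (\<Oplus>\<^bsub>P\<^esub>l\<in>{1..m}. up_ring.monom P (\<gamma> l) 0 \<otimes>\<^bsub>P\<^esub> f \<otimes>\<^bsub>P\<^esub> up_ring.monom P (\<delta> l) 0) \<otimes>\<^bsub>P\<^esub> up_ring.monom P \<one> j"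

context
  fixes f m \<gamma> \<delta>
  assumes f: "f \<in> carrier P" and coeffs: "\<gamma> \<in> {1..m::nat} \<rightarrow> carrier R" "\<delta> \<in> {1..m} \<rightarrow> carrier R"
begin

lemma shifted_sum_closed: "shifted_sum f m \<gamma> \<delta> j \<in> carrier P"
  unfolding shifted_sum_def using f coeffs
  by (intro UP_mult_closed P.finsum_closed) (auto simp: Pi_iff)

lemma shifted_sum_in_Idl: "shifted_sum f m \<gamma> \<delta> j \<in> Idl\<^bsub>P\<^esub> {f}"
proof -
  interpret I: ideal "Idl\<^bsub>P\<^esub> {f}" P using f by (intro P.genideal_ideal) simp
  have "f \<in> Idl\<^bsub>P\<^esub> {f}" using P.genideal_self'[OF f] .
  then show ?thesis
    unfolding shifted_sum_def using coeffs
    by (intro I.I_r_closed I.finsum_in_ideal funcsetI I.I_r_closed[OF I.I_l_closed]) (auto simp: Pi_iff)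
qed

text \<open>Constant factors act on each coefficient separately, and the monomial shifts the indices
  by \<open>j\<close>.\<close>

lemma coeff_shifted_sum:
  "up_ring.coeff P (shifted_sum f m \<gamma> \<delta> j) n =
     (if j \<le> n then \<Oplus>l\<in>{1..m}. \<gamma> l \<otimes> up_ring.coeff P f (n - j) \<otimes> \<delta> l else \<zero>)"
proof -
  have c: "(\<lambda>l. up_ring.monom P (\<gamma> l) 0 \<otimes>\<^bsub>P\<^esub> f \<otimes>\<^bsub>P\<^esub> up_ring.monom P (\<delta> l) 0) \<in> {1..m} \<rightarrow> carrier P"
    using f coeffs by (auto simp: Pi_iff)
  have "up_ring.coeff P (\<Oplus>\<^bsub>P\<^esub>l\<in>{1..m}. up_ring.monom P (\<gamma> l) 0 \<otimes>\<^bsub>P\<^esub> f \<otimes>\<^bsub>P\<^esub> up_ring.monom P (\<delta> l) 0) k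
      = (\<Oplus>l\<in>{1..m}. up_ring.coeff P (up_ring.monom P (\<gamma> l) 0 \<otimes>\<^bsub>P\<^esub> f \<otimes>\<^bsub>P\<^esub> up_ring.monom P (\<delta> l) 0) k)" for k
    using c by (intro coeff_finsum) auto
  also have "\<dots> k = (\<Oplus>l\<in>{1..m}. \<gamma> l \<otimes> up_ring.coeff P f k \<otimes> \<delta> l)" for k
    using f coeffs
    by (intro R.finsum_cong')
      (auto simp: Pi_iff coeff_mult_monom monom_mult_is_smult simp del: coeff_mult)
  finally have sum: "up_ring.coeff P (\<Oplus>\<^bsub>P\<^esub>l\<in>{1..m}. up_ring.monom P (\<gamma> l) 0 \<otimes>\<^bsub>P\<^esub> f \<otimes>\<^bsub>P\<^esub> up_ring.monom P (\<delta> l) 0) k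
      = (\<Oplus>l\<in>{1..m}. \<gamma> l \<otimes> up_ring.coeff P f k \<otimes> \<delta> l)" for k .
  have "(\<Oplus>l\<in>{1..m}. \<gamma> l \<otimes> up_ring.coeff P f k \<otimes> \<delta> l) \<in> carrier R" for k
    using f coeffs by (intro R.finsum_closed) (auto simp: Pi_iff)
  then show ?thesis
    unfolding shifted_sum_def
    using c by (simp only: coeff_mult_monom[OF P.finsum_closed[OF c] R.one_closed] sum R.r_one)
qed

end

section \<open>Ideals of leading coefficients\<close>

definition coeff_ideal :: "(nat \<Rightarrow> 'a) set \<Rightarrow> nat \<Rightarrow> 'a set" where
  "coeff_ideal J n = {up_ring.coeff P p n | p. p \<in> J \<and> (\<forall>k>n. up_ring.coeff P p k = \<zero>)}"

text \<open>Sums, and products with constants on either side, respect the degree bound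
  \<open>n\<close> and act accordingly on the coefficient at \<open>n\<close>.\<close>

lemma ideal_coeff_ideal:
  assumes "ideal J P"
  shows "ideal (coeff_ideal J n) R"
proof (rule R.idealI_mult_closed)
  interpret J: ideal J P by fact
  show "coeff_ideal J n \<subseteq> carrier R" unfolding coeff_ideal_def using J.Icarr by auto
  show "\<zero> \<in> coeff_ideal J n"
    unfolding coeff_ideal_def using J.zero_closed by (auto intro!: exI[of _ "\<zero>\<^bsub>P\<^esub>"])
  fix x assume "x \<in> coeff_ideal J n"
  then obtain p where p: "p \<in> J" "x = up_ring.coeff P p n" "\<forall>k>n. up_ring.coeff P p k = \<zero>"
    unfolding coeff_ideal_def by blast
  have pc: "p \<in> carrier P" using J.Icarr p(1) .
  { fix y assume "y \<in> coeff_ideal J n"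
    then obtain q where q: "q \<in> J" "y = up_ring.coeff P q n" "\<forall>k>n. up_ring.coeff P q k = \<zero>"
      unfolding coeff_ideal_def by blast
    have "q \<in> carrier P" using J.Icarr q(1) .
    then show "x \<oplus> y \<in> coeff_ideal J n"
      unfolding coeff_ideal_def mem_Collect_eq
      using p q pc J.a_closed[OF p(1) q(1)] by (intro exI[of _ "p \<oplus>\<^bsub>P\<^esub> q"]) simp }
  fix r assume r: "r \<in> carrier R"
  have "up_ring.monom P r 0 \<otimes>\<^bsub>P\<^esub> p \<in> J" using J.I_l_closed[OF p(1)] r by simp
  then show "r \<otimes> x \<in> coeff_ideal J n"
    unfolding coeff_ideal_def mem_Collect_eq
    using p pc r by (intro exI[of _ "up_ring.monom P r 0 \<otimes>\<^bsub>P\<^esub> p"]) (simp add: monom_mult_is_smult)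
  have "p \<otimes>\<^bsub>P\<^esub> up_ring.monom P r 0 \<in> J" using J.I_r_closed[OF p(1)] r by simp
  then show "x \<otimes> r \<in> coeff_ideal J n"
    unfolding coeff_ideal_def mem_Collect_eq
    using p pc r
    by (intro exI[of _ "p \<otimes>\<^bsub>P\<^esub> up_ring.monom P r 0"]) (simp add: coeff_mult_monom del: coeff_mult)
qed

text \<open>Multiplying by X^(n - m) moves the coefficient at \<open>m\<close> to \<open>n\<close>
  and stays in \<open>J\<close>.\<close>

lemma coeff_ideal_mono:
  assumes "ideal J P" "m \<le> n"
  shows "coeff_ideal J m \<subseteq> coeff_ideal J n"
proof
  interpret J: ideal J P by fact
  fix x assume "x \<in> coeff_ideal J m"
  then obtain p where p: "p \<in> J" "x = up_ring.coeff P p m" "\<forall>k>m. up_ring.coeff P p k = \<zero>"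
    unfolding coeff_ideal_def by blast
  have pc: "p \<in> carrier P" using J.Icarr p(1) .
  have "p \<otimes>\<^bsub>P\<^esub> up_ring.monom P \<one> (n - m) \<in> J" using J.I_r_closed[OF p(1)] by simp
  then show "x \<in> coeff_ideal J n"
    unfolding coeff_ideal_def mem_Collect_eq
    using p pc assms(2)
    by (intro exI[of _ "p \<otimes>\<^bsub>P\<^esub> up_ring.monom P \<one> (n - m)"]) (simp add: coeff_mult_monom del: coeff_mult)
qed

text \<open>In a Noetherian ring a non-empty chain of ideals contains its union; a stage equal to
  the union also equals all later stages.\<close>

lemma coeff_ideal_stabilises:
  assumes "noetherian_ring R" and J: "ideal J P"
  shows "\<exists>N. \<forall>n\<ge>N. coeff_ideal J n = coeff_ideal J N"
proof -
  interpret noetherian_ring R by fact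
  have "coeff_ideal J m \<subseteq> coeff_ideal J n \<or> coeff_ideal J n \<subseteq> coeff_ideal J m" for m n
    using coeff_ideal_mono[OF J] by (meson nat_le_linear)
  then have "subset.chain {I. ideal I R} (range (coeff_ideal J))"
    using ideal_coeff_ideal[OF J] unfolding subset_chain_def by auto
  then have "\<Union>(range (coeff_ideal J)) \<in> range (coeff_ideal J)"
    by (intro ideal_chain_is_trivial) auto
  then obtain N where "\<Union>(range (coeff_ideal J)) = coeff_ideal J N" by auto
  then show ?thesis using coeff_ideal_mono[OF J, of N] by (intro exI[of _ N]) blast
qed

end

section \<open>Reduction steps on polynomials\<close>

locale UP_reduction = UP_ring R P + reduction_relation R red
  for R (structure) and P (structure) and red
begin

lemma poly_red_iff:
  "poly_red R red f p q \<longleftrightarrow>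
     f \<in> carrier P - {\<zero>\<^bsub>P\<^esub>} \<and> p \<in> carrier P - {\<zero>\<^bsub>P\<^esub>} \<and>
     (\<exists>j \<beta> m \<gamma> \<delta>. up_ring.coeff P p (deg R f + j) \<noteq> \<zero> \<and>
        red (head_coeff R f) (up_ring.coeff P p (deg R f + j)) \<beta> \<and>
        \<beta> \<in> carrier R \<and> \<gamma> \<in> {1..m::nat} \<rightarrow> carrier R \<and> \<delta> \<in> {1..m} \<rightarrow> carrier R \<and>
        up_ring.coeff P p (deg R f + j) = \<beta> \<oplus> (\<Oplus>l\<in>{1..m}. \<gamma> l \<otimes> head_coeff R f \<otimes> \<delta> l) \<and>
        q = p \<ominus>\<^bsub>P\<^esub> shifted_sum f m \<gamma> \<delta> j)"
  unfolding poly_red_def shifted_sum_def P_def by blast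

lemma head_coeff_closed: "f \<in> carrier P \<Longrightarrow> head_coeff R f \<in> carrier R"
  unfolding head_coeff_def by (fold P_def) simp

lemma head_coeff_nonzero: "f \<in> carrier P \<Longrightarrow> f \<noteq> \<zero>\<^bsub>P\<^esub> \<Longrightarrow> head_coeff R f \<noteq> \<zero>"
  unfolding head_coeff_def by (fold P_def) (rule lcoeff_nonzero)

text \<open>The subtracted polynomial has no coefficients above \<open>deg R f + j\<close>, and its
  coefficient there is exactly the sum by which \<open>\<alpha>\<close> and \<open>\<beta>\<close>
  differ. Lower coefficients may change arbitrarily.\<close>

lemma poly_redD:
  assumes "poly_red R red f p q"
  shows "f \<in> carrier P" "p \<in> carrier P" "q \<in> carrier P" "p \<ominus>\<^bsub>P\<^esub> q \<in> Idl\<^bsub>P\<^esub> {f}"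
    and "\<exists>i. red (head_coeff R f) (up_ring.coeff P p i) (up_ring.coeff P q i) \<and>
      (\<forall>k>i. up_ring.coeff P q k = up_ring.coeff P p k)"
proof -
  obtain j \<beta> m \<gamma> \<delta> where f: "f \<in> carrier P" and p: "p \<in> carrier P"
    and r: "red (head_coeff R f) (up_ring.coeff P p (deg R f + j)) \<beta>"
    and bc: "\<beta> \<in> carrier R" "\<gamma> \<in> {1..m::nat} \<rightarrow> carrier R" "\<delta> \<in> {1..m} \<rightarrow> carrier R"
    and e: "up_ring.coeff P p (deg R f + j) = \<beta> \<oplus> (\<Oplus>l\<in>{1..m}. \<gamma> l \<otimes> head_coeff R f \<otimes> \<delta> l)"
    and q: "q = p \<ominus>\<^bsub>P\<^esub> shifted_sum f m \<gamma> \<delta> j"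
    using assms unfolding poly_red_iff by blast
  let ?s = "shifted_sum f m \<gamma> \<delta> j"
  note s = shifted_sum_closed[OF f bc(2,3)]
  show "f \<in> carrier P" "p \<in> carrier P" by fact+
  show "q \<in> carrier P" unfolding q using p s by simp
  have "p \<ominus>\<^bsub>P\<^esub> q = ?s"
    unfolding q using p s[of j] by (simp add: a_minus_def P.minus_add P.r_neg2)
  then show "p \<ominus>\<^bsub>P\<^esub> q \<in> Idl\<^bsub>P\<^esub> {f}" using shifted_sum_in_Idl[OF f bc(2,3)] by simp
  let ?i = "deg R f + j"
  have hc: "up_ring.coeff P f (deg R f) = head_coeff R f" unfolding head_coeff_def P_def ..
  let ?t = "\<Oplus>l\<in>{1..m}. \<gamma> l \<otimes> head_coeff R f \<otimes> \<delta> l"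
  have tc: "?t \<in> carrier R"
    using head_coeff_closed[OF f] bc by (intro R.finsum_closed) (auto simp: Pi_iff)
  have "up_ring.coeff P q ?i = (\<beta> \<oplus> ?t) \<ominus> ?t"
    unfolding q coeff_minus[OF p s] e coeff_shifted_sum[OF f bc(2,3)] by (simp add: hc)
  also have "\<dots> = \<beta>" using bc(1) tc by (simp add: a_minus_def R.a_assoc R.r_neg)
  finally have qi: "up_ring.coeff P q ?i = \<beta>" .
  have "up_ring.coeff P q k = up_ring.coeff P p k" if k: "k > ?i" for k
  proof -
    have "up_ring.coeff P f (k - j) = \<zero>" using k f by (intro deg_aboveD) auto
    then have "(\<Oplus>l\<in>{1..m}. \<gamma> l \<otimes> up_ring.coeff P f (k - j) \<otimes> \<delta> l) = (\<Oplus>l\<in>{1..m}. \<zero>)"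
      using bc by (intro R.finsum_cong') (auto simp: Pi_iff)
    then show ?thesis
      unfolding q coeff_minus[OF p s] coeff_shifted_sum[OF f bc(2,3)]
      using k p by (simp add: a_minus_def)
  qed
  then show "\<exists>i. red (head_coeff R f) (up_ring.coeff P p i) (up_ring.coeff P q i) \<and>
      (\<forall>k>i. up_ring.coeff P q k = up_ring.coeff P p k)"
    using r qi by blast
qed

text \<open>(A2) puts the change of the coefficient into the ideal of the head coefficient, so
  suitable \<open>\<gamma>\<close> and \<open>\<delta>\<close> always exist. The coefficient is
  non-zero because \<open>\<zero>\<close> is irreducible.\<close>

lemma poly_red_ex:
  assumes f: "f \<in> carrier P" "f \<noteq> \<zero>\<^bsub>P\<^esub>" and p: "p \<in> carrier P" and i: "deg R f \<le> i"
    and r: "red (head_coeff R f) (up_ring.coeff P p i) \<beta>"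
  shows "\<exists>q. poly_red R red f p q"
proof -
  let ?a = "up_ring.coeff P p i"
  have h: "head_coeff R f \<in> carrier R" using f by (simp add: head_coeff_closed)
  have b: "\<beta> \<in> carrier R" using red_closed[OF h r] by simp
  have "?a \<ominus> \<beta> \<in> R.two_sided_sums (head_coeff R f)"
    using A2[OF h r] R.Idl_singleton_subset[OF h] by blast
  then obtain m \<gamma> \<delta> where g: "\<gamma> \<in> {1..m::nat} \<rightarrow> carrier R" "\<delta> \<in> {1..m} \<rightarrow> carrier R"
    "?a \<ominus> \<beta> = (\<Oplus>l\<in>{1..m}. \<gamma> l \<otimes> head_coeff R f \<otimes> \<delta> l)"
    unfolding R.two_sided_sums_def by blast
  have "?a = \<beta> \<oplus> (?a \<ominus> \<beta>)"
    using b p by (simp add: a_minus_def R.a_comm[of "?a"] R.r_neg2)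
  moreover have "?a \<noteq> \<zero>" using zero_irreducible[OF h] r by metis
  moreover have "p \<noteq> \<zero>\<^bsub>P\<^esub>" using \<open>?a \<noteq> \<zero>\<close> by auto
  ultimately have "poly_red R red f p (p \<ominus>\<^bsub>P\<^esub> shifted_sum f m \<gamma> \<delta> (i - deg R f))"
    unfolding poly_red_iff using f p i r b g
    by (intro conjI exI[of _ "i - deg R f"] exI[of _ \<beta>] exI[of _ m] exI[of _ \<gamma>] exI[of _ \<delta>]) auto
  then show ?thesis by blast
qed

text \<open>
  A reduction step makes the coefficient list, read from the top, lexicographically smaller.
\<close>

lemma terminating_poly_red:
  assumes F: "finite F" "F \<subseteq> carrier P"
  shows "terminating (red_set (poly_red R red) F)"
  unfolding terminating_iff_no_chain
proof
  assume "\<exists>p. \<forall>i::nat. red_set (poly_red R red) F (p i) (p (Suc i))"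
  then obtain p where p: "\<And>i::nat. red_set (poly_red R red) F (p i) (p (Suc i))" by blast
  \<comment> \<open>All steps act at their top position through these finitely many coefficients, so
    (A1) in \<open>R\<close> applies.\<close>
  let ?H = "head_coeff R ` F"
  have H: "finite ?H" "?H \<subseteq> carrier R" using F head_coeff_closed by auto
  have pc: "p i \<in> carrier P" for i
    using p[of i] poly_redD(2) unfolding red_set_def by blast
  have step: "\<exists>i. red_set red ?H (up_ring.coeff P (p k) i) (up_ring.coeff P (p (Suc k)) i) \<and>
      (\<forall>l>i. up_ring.coeff P (p (Suc k)) l = up_ring.coeff P (p k) l)" for k
    using p[of k] poly_redD(5) unfolding red_set_def by blast
  define N where "N = deg R (p 0)"
  \<comment> \<open>A step needs a non-zero coefficient, so it takes place within the current degree
    bound; hence the initial degree bounds the whole chain.\<close>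
  have le: "i \<le> N" if "red_set red ?H (up_ring.coeff P (p k) i) c" "\<forall>l>N. up_ring.coeff P (p k) l = \<zero>" for k i c
    using that zero_irreducible H(2) unfolding red_set_def by (metis not_le subsetD)
  have bound: "\<forall>l>N. up_ring.coeff P (p k) l = \<zero>" for k
  proof (induction k)
    case 0
    show ?case unfolding N_def using deg_aboveD pc by blast
  next
    case (Suc k)
    obtain i where i: "red_set red ?H (up_ring.coeff P (p k) i) (up_ring.coeff P (p (Suc k)) i)"
      "\<forall>l>i. up_ring.coeff P (p (Suc k)) l = up_ring.coeff P (p k) l" using step by blast
    then show ?case using le[OF i(1) Suc] Suc by simp
  qed
  \<comment> \<open>Highest coefficient first, padded to the common length \<open>Suc N\<close> that
    \<open>lexn\<close> compares.\<close>
  define cs where "cs k = map (\<lambda>l. up_ring.coeff P (p k) (N - l)) [0..<Suc N]" for k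
  let ?r = "{(y, x). red_set red ?H x y}"
  have "wf ?r" using A1[OF H] unfolding terminating_def wfp_def by (rule wf_subset) auto
  then have "wf (lexn ?r (Suc N))" by (rule wf_lexn)
  moreover have "(cs (Suc k), cs k) \<in> lexn ?r (Suc N)" for k
  proof -
    obtain i where i: "red_set red ?H (up_ring.coeff P (p k) i) (up_ring.coeff P (p (Suc k)) i)"
      "\<forall>l>i. up_ring.coeff P (p (Suc k)) l = up_ring.coeff P (p k) l" using step by blast
    have iN: "i \<le> N" using le[OF i(1) bound] .
    \<comment> \<open>The coefficient of X^i stands at position \<open>N - i\<close>; the entries
      before it belong to higher powers and stay fixed.\<close>
    have "[0..<Suc N] = [0..<N - i] @ (N - i) # [Suc (N - i)..<Suc N]"
      using upt_add_eq_append[of 0 "N - i" "Suc i"] upt_conv_Cons[of "N - i" "Suc N"] iN by simp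
    then have split: "\<exists>zs. cs k' = map (\<lambda>l. up_ring.coeff P (p k') (N - l)) [0..<N - i] @
        up_ring.coeff P (p k') i # zs" for k'
      unfolding cs_def using iN by simp
    define pre where "pre = map (\<lambda>l. up_ring.coeff P (p k) (N - l)) [0..<N - i]"
    have "map (\<lambda>l. up_ring.coeff P (p (Suc k)) (N - l)) [0..<N - i] = pre"
      unfolding pre_def using i(2) by simp
    then obtain xs ys where "cs (Suc k) = pre @ up_ring.coeff P (p (Suc k)) i # xs"
      "cs k = pre @ up_ring.coeff P (p k) i # ys"
      using split[of k, folded pre_def] split[of "Suc k"] by metis
    moreover have "length (cs k') = Suc N" for k' unfolding cs_def by simp
    ultimately show ?thesis
      unfolding lexn_conv mem_Collect_eq prod.case using i(1) by blast
  qed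
  ultimately show False unfolding wf_iff_no_infinite_down_chain by blast
qed

lemma reduction_relation_UP: "reduction_relation P (poly_red R red)"
proof unfold_locales
  fix f p q assume "poly_red R red f p q"
  then show "p \<in> carrier P \<and> q \<in> carrier P" "p \<ominus>\<^bsub>P\<^esub> q \<in> Idl\<^bsub>P\<^esub> {f}"
    using poly_redD by blast+
next
  fix F assume "finite F" "F \<subseteq> carrier P"
  then show "terminating (red_set (poly_red R red) F)" by (rule terminating_poly_red)
next
  fix f assume f: "f \<in> carrier P - {\<zero>\<^bsub>P\<^esub>}"
  let ?h = "head_coeff R f"
  have h: "?h \<in> carrier R" "?h \<noteq> \<zero>" using f head_coeff_closed head_coeff_nonzero by auto
  have hc: "up_ring.coeff P f (deg R f) = ?h" unfolding head_coeff_def P_def ..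
  \<comment> \<open>(A3) uses one summand with both factors \<open>\<one>\<close> and shift 0; in
    \<open>R\<close> the head coefficient reduces to \<open>\<zero>\<close>.\<close>
  have "shifted_sum f 1 (\<lambda>_. \<one>) (\<lambda>_. \<one>) 0 = f"
    using f unfolding shifted_sum_def by (simp add: P.finsum_insert)
  then have "f \<ominus>\<^bsub>P\<^esub> shifted_sum f 1 (\<lambda>_. \<one>) (\<lambda>_. \<one>) 0 = \<zero>\<^bsub>P\<^esub>"
    using f by (simp add: a_minus_def P.r_neg)
  then show "poly_red R red f f \<zero>\<^bsub>P\<^esub>"
    unfolding poly_red_iff using f h A3[of ?h]
    by (intro conjI exI[of _ 0] exI[of _ \<zero>] exI[of _ 1] exI[of _ "\<lambda>_. \<one>"]) (auto simp: hc)
qed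

end

section \<open>Passage from R to R[X]\<close>

lemma noetherian_reduction_ring_UP:
  fixes R (structure)
  assumes "noetherian_reduction_ring R red"
  shows "noetherian_reduction_ring (UP R) (poly_red R red)"
proof -
  define P where "P = UP R"
  interpret R: noetherian_reduction_ring R red by fact
  interpret UP_reduction R P red by unfold_locales (simp add: P_def)
  interpret PR: reduction_relation P "poly_red R red" by (rule reduction_relation_UP)
  have "\<exists>B. finite B \<and> B \<subseteq> J \<and> separates_normal_forms P (poly_red R red) J B"
    if J: "ideal J P" for J
  proof -
    interpret J: ideal J P by fact
    obtain N where N: "\<And>n. n \<ge> N \<Longrightarrow> coeff_ideal J n = coeff_ideal J N"
      using coeff_ideal_stabilises[OF R.noetherian_ring_axioms J] by blast
    have "\<forall>n. \<exists>G. finite G \<and> G \<subseteq> coeff_ideal J n \<and> separates_normal_forms R red (coeff_ideal J n) G"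
      using R.ex_separating_set[OF ideal_coeff_ideal[OF J]] by blast
    then obtain G where G: "\<And>n. finite (G n)" "\<And>n. G n \<subseteq> coeff_ideal J n"
      "\<And>n. separates_normal_forms R red (coeff_ideal J n) (G n)" by metis
    have "\<forall>n g. \<exists>p. g \<in> G n \<longrightarrow> p \<in> J \<and> up_ring.coeff P p n = g \<and> (\<forall>k>n. up_ring.coeff P p k = \<zero>)"
      using G(2) unfolding coeff_ideal_def by blast
    then obtain f where f: "\<And>n g. g \<in> G n \<Longrightarrow> f n g \<in> J"
      "\<And>n g. g \<in> G n \<Longrightarrow> up_ring.coeff P (f n g) n = g"
      "\<And>n g k. g \<in> G n \<Longrightarrow> k > n \<Longrightarrow> up_ring.coeff P (f n g) k = \<zero>" by metis
    \<comment> \<open>For non-zero \<open>g\<close> in \<open>G n\<close> the polynomial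
      \<open>f n g\<close> has degree exactly \<open>n\<close> and head coefficient
      \<open>g\<close>; as an index \<open>\<zero>\<close> admits no steps, so nothing is
      lost.\<close>
    define B where "B = (\<Union>n\<le>N. f n ` (G n - {\<zero>}))"
    have B: "finite B" "B \<subseteq> J" unfolding B_def using G(1) f(1) by auto
    \<comment> \<open>A reducer \<open>g\<close> of the coefficient at \<open>i\<close> would make
      \<open>f n g\<close> reduce \<open>p\<close> there, since its degree \<open>n\<close> is at
      most \<open>i\<close>.\<close>
    have irred: "\<nexists>c. red_set red (G n) (up_ring.coeff P p i) c"
      if p: "p \<in> carrier P" "\<nexists>q. red_set (poly_red R red) B p q" and n: "n \<le> N" "n \<le> i" for p n i
    proof
      assume "\<exists>c. red_set red (G n) (up_ring.coeff P p i) c"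
      then obtain g c where g: "g \<in> G n" "red g (up_ring.coeff P p i) c" unfolding red_set_def by blast
      have g0: "g \<noteq> \<zero>" using R.red_zero_index g(2) by blast
      have fc: "f n g \<in> carrier P" using f(1)[OF g(1)] by (rule J.Icarr)
      have f0: "f n g \<noteq> \<zero>\<^bsub>P\<^esub>" using f(2)[OF g(1)] g0 by auto
      have "deg R (f n g) = n"
        using f(2,3)[OF g(1)] g0 fc
        by (intro order_antisym deg_aboveI deg_belowI) auto
      moreover from this have "head_coeff R (f n g) = g"
        using f(2)[OF g(1)] unfolding head_coeff_def P_def by simp
      ultimately obtain q where "poly_red R red (f n g) p q"
        using poly_red_ex[OF fc f0 p(1)] n(2) g(2) by metis
      then show False using p(2) g(1) g0 n(1) unfolding red_set_def B_def by blast
    qed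
    have "separates_normal_forms P (poly_red R red) J B"
      unfolding separates_normal_forms_def
    proof (intro ballI impI)
      fix p q assume pq: "p \<in> carrier P" "q \<in> carrier P" "p \<ominus>\<^bsub>P\<^esub> q \<in> J"
        and np: "\<nexists>r. red_set (poly_red R red) B p r" and nq: "\<nexists>r. red_set (poly_red R red) B q r"
      show "p = q"
      proof (rule ccontr)
        assume "p \<noteq> q"
        define i where "i = deg R (p \<ominus>\<^bsub>P\<^esub> q)"
        \<comment> \<open>The cap at \<open>N\<close> keeps \<open>n\<close> among the degrees
          covered by \<open>B\<close>, while the coefficient ideals at \<open>i\<close> and
          \<open>n\<close> coincide.\<close>
        define n where "n = min i N"
        have d: "p \<ominus>\<^bsub>P\<^esub> q \<in> carrier P" "p \<ominus>\<^bsub>P\<^esub> q \<noteq> \<zero>\<^bsub>P\<^esub>"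
          using pq \<open>p \<noteq> q\<close> by simp_all
        \<comment> \<open>This is the head coefficient of the difference, which lies in
          \<open>J\<close>.\<close>
        have "up_ring.coeff P p i \<ominus> up_ring.coeff P q i \<in> coeff_ideal J i"
          unfolding coeff_ideal_def mem_Collect_eq
          using pq(3) deg_aboveD[OF _ d(1)]
          by (intro exI[of _ "p \<ominus>\<^bsub>P\<^esub> q"]) (simp add: coeff_minus[OF pq(1,2)] i_def)
        also have "coeff_ideal J i = coeff_ideal J n"
          unfolding n_def using N[of i] by (simp add: min_def)
        finally have "up_ring.coeff P p i = up_ring.coeff P q i"
          using G(3)[of n] irred[OF pq(1) np, of n i] irred[OF pq(2) nq, of n i] pq
          unfolding separates_normal_forms_def n_def by simp
        then have "up_ring.coeff P (p \<ominus>\<^bsub>P\<^esub> q) i = \<zero>"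
          using pq(1,2) by (simp add: coeff_minus a_minus_def R.r_neg)
        then show False using lcoeff_nonzero[OF d(2,1)] unfolding i_def by simp
      qed
    qed
    then show ?thesis using B by blast
  qed
  then show ?thesis using PR.noetherian_reduction_ringI unfolding P_def by blast
qed

theorem corollary3p5p3:
  fixes R :: "('a, 'm) ring_scheme"
    and red :: "'a \<Rightarrow> 'a \<Rightarrow> 'a \<Rightarrow> bool"
    and n :: nat
  assumes "noetherian_reduction_ring R red"
    and "n \<ge> 1"
  shows "noetherian_reduction_ring (iter_poly_ring R n) (iter_poly_red R red n)"
proof -
  \<comment> \<open>The base is the renamed copy of \<open>R\<close>; each further stage adjoins one
    variable and renames along \<open>Poly\<close>.\<close>
  have "noetherian_reduction_ring (iter_poly_ring R n) (iter_poly_red R red n)" for n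
  proof (induction n)
    case 0
    then show ?case using noetherian_reduction_ring_image[OF assms(1), of Coeff] by (simp add: inj_def)
  next
    case (Suc n)
    have "inj Poly" by (simp add: inj_def)
    then show ?case
      using noetherian_reduction_ring_image[OF noetherian_reduction_ring_UP[OF Suc]] by simp
  qed
  then show ?thesis .
qed

end
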